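(* The sequence $(S_n)_{n\ge0}$ of large Schröder numbers is log-convex, i.e. $S_n^2\le S_{n-1}S_{n+1}$ for all $n\ge1$.
   Context: A Schröder path of semilength $n$ is a lattice path that starts at $(0,0)$, ends at $(2n,0)$, uses steps $U=[1,1]$, $D=[1,-1]$, $T=[2,0]$, and never goes below the $x$-axis. The $n$th large Schröder number $S_n$ is the number of Schröder paths of semilength $n$. *)

theory Defs
  imports Main "HOL-Library.Product_Plus"
begin

datatype step = U | D | T

fun step_vec :: "step \<Rightarrow> int \<times> int" where
  "step_vec U = (1, 1)"
| "step_vec D = (1, -1)"
| "step_vec T = (2, 0)"

text \<open>A lattice path starting at the origin is given by its list of steps; \<open>endpoint p\<close> is
  the lattice point it reaches.\<close>

definition endpoint :: "step list \<Rightarrow> int \<times> int" where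
  "endpoint p = (\<Sum>s\<leftarrow>p. step_vec s)"

text \<open>All steps are straight, so it suffices to require that the points between consecutive
  steps (the endpoints of the prefixes) do not lie below the axis.\<close>

definition schroeder_path :: "nat \<Rightarrow> step list \<Rightarrow> bool" where
  "schroeder_path n p \<longleftrightarrow>
     endpoint p = (2 * int n, 0) \<and> (\<forall>k\<le>length p. 0 \<le> snd (endpoint (take k p)))"

definition large_schroeder :: "nat \<Rightarrow> nat" where
  "large_schroeder n = card {p. schroeder_path n p}"

definition log_convex :: "(nat \<Rightarrow> 'a::linordered_semidom) \<Rightarrow> bool" where
  "log_convex a \<longleftrightarrow> (\<forall>n\<ge>1. (a n)\<^sup>2 \<le> a (n - 1) * a (n + 1))"

lemma length_le_endpoint: "int (length p) \<le> fst (endpoint p)"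
proof (induction p)
  case Nil
  show ?case by (simp add: endpoint_def)
next
  case (Cons s p)
  then show ?case by (cases s) (simp_all add: endpoint_def)
qed

text \<open>Hence the cardinality in the definition of \<open>large_schroeder\<close> is a genuine count.\<close>

lemma finite_schroeder_paths: "finite {p. schroeder_path n p}"
proof (rule finite_subset)
  have fin: "finite (UNIV :: step set)"
  proof (rule finite_subset)
    show "(UNIV :: step set) \<subseteq> {U, D, T}"
      using step.exhaust by blast
  qed simp
  show "finite {p :: step list. set p \<subseteq> UNIV \<and> length p \<le> 2 * n}"
    by (rule finite_lists_length_le[OF fin])
  show "{p. schroeder_path n p} \<subseteq> {p. set p \<subseteq> UNIV \<and> length p \<le> 2 * n}"
  proof
    fix p assume "p \<in> {p. schroeder_path n p}"
    with length_le_endpoint[of p] show "p \<in> {p. set p \<subseteq> UNIV \<and> length p \<le> 2 * n}"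
      by (simp add: schroeder_path_def)
  qed
qed

end

theory Submission
  imports Defs "HOL-Computational_Algebra.Formal_Power_Series"
begin

text \<open>
  Log-convexity says that the quotients \<open>S (n + 1) / S n\<close> increase, and this is read off from the
  three-term recurrence \<open>(n + 3) S (n + 2) = 3 (2 n + 3) S (n + 1) - n S n\<close>
  (lemma \<open>large_schroeder_three_term\<close>).  Put \<open>d, a, b, c\<close> for four consecutive numbers ending at
  \<open>c = S (n + 3)\<close>.  Multiplying \<open>a c - b\<^sup>2\<close> by the leading coefficients and eliminating the
  highest term of each of the two recurrences leaves
  \<open>9 a b - (n + 1) (n + 3) a\<^sup>2 + n (n + 4) b d\<close>.  If the claim \<open>a\<^sup>2 \<le> b d\<close> is known one step earlier,
  this is at least \<open>9 a b - 3 a\<^sup>2\<close>, which is nonnegative because \<open>a \<le> b\<close>.  So log-convexity follows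
  by induction.

  The recurrence comes from the structure of the paths.  A nonempty path starts with \<open>T\<close>, or it
  starts with \<open>U\<close> and has a first return to the axis, which splits it uniquely as
  \<open>U p D q\<close> with Schroeder paths \<open>p\<close> and \<open>q\<close>.  Hence the generating function satisfies
  \<open>F = 1 + X F + X F\<^sup>2\<close>.  Completing the square, \<open>G = 1 - X - 2 X F\<close> is a square root
  of \<open>1 - 6 X + X\<^sup>2\<close>.  Such a root satisfies the linear differential equation
  \<open>(1 - 6 X + X\<^sup>2) G' = (X - 3) G\<close>, whose coefficients are the three-term recurrence.
\<close>

unbundle fps_syntax

section \<open>Decomposition of paths at the first return to the axis\<close>

text \<open>
  Paths that start at an arbitrary height \<open>h\<close>, end on the axis and never go below it.  Recursion on
  the steps, with varying \<open>h\<close>, replaces the condition on all prefixes.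
\<close>

fun descends :: "int \<Rightarrow> step list \<Rightarrow> bool" where
  "descends h [] \<longleftrightarrow> h = 0"
| "descends h (s # p) \<longleftrightarrow> 0 \<le> h \<and> descends (h + snd (step_vec s)) p"

lemma endpoint_Nil [simp]: "endpoint [] = 0"
  by (simp add: endpoint_def)

lemma endpoint_Cons [simp]: "endpoint (s # p) = step_vec s + endpoint p"
  by (simp add: endpoint_def)

lemma endpoint_append [simp]: "endpoint (p @ q) = endpoint p + endpoint q"
  by (simp add: endpoint_def)

lemma descends_iff_prefix_heights:
  "descends h p \<longleftrightarrow>
     h + snd (endpoint p) = 0 \<and> (\<forall>k\<le>length p. 0 \<le> h + snd (endpoint (take k p)))"
proof (induction p arbitrary: h)
  case Nil
  show ?case by auto
next
  case (Cons s p)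
  have "(\<forall>k\<le>length (s # p). 0 \<le> h + snd (endpoint (take k (s # p)))) \<longleftrightarrow>
    0 \<le> h \<and> (\<forall>k\<le>length p. 0 \<le> h + snd (step_vec s) + snd (endpoint (take k p)))"
    by (auto simp: add.assoc All_less_Suc2 simp flip: less_Suc_eq_le)
  then show ?case
    by (auto simp: Cons.IH add.assoc)
qed

lemma schroeder_path_iff_descends:
  "schroeder_path n p \<longleftrightarrow> descends 0 p \<and> fst (endpoint p) = 2 * int n"
  unfolding schroeder_path_def descends_iff_prefix_heights by (auto simp: prod_eq_iff)

lemma descends_nonneg: "descends h p \<Longrightarrow> 0 \<le> h"
  by (cases p) auto

text \<open>
  Raised by \<open>g\<close>, the path \<open>p\<close> never goes below level \<open>g\<close> and ends on it, so only \<open>q\<close> matters.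
\<close>

lemma descends_append:
  assumes "descends h p" and "0 \<le> g"
  shows "descends (h + g) (p @ q) \<longleftrightarrow> descends g q"
  using assms
proof (induction p arbitrary: h)
  case Nil
  then show ?case by simp
next
  case (Cons s p)
  then have "descends (h + snd (step_vec s) + g) (p @ q) \<longleftrightarrow> descends g q"
    by simp
  then show ?case
    using Cons.prems by (simp add: ac_simps)
qed

text \<open>
  A path from positive height is cut at the first step that goes below its starting height.
  If it starts with \<open>U\<close>, then the cut is found by descending two levels, one after the other.
\<close>

lemma descends_first_passage:
  assumes "descends (h + 1) p" and "0 \<le> h"
  shows "\<exists>q r. p = q @ D # r \<and> descends 0 q \<and> descends h r"
  using assms
proof (induction p arbitrary: h rule: length_induct)
  case (1 p h)
  note IH = 1(1)[rule_format]
  obtain s p' where p: "p = s # p'"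
    using 1(2,3) by (cases p) auto
  show ?case
  proof (cases s)
    case U
    then have "descends (h + 1 + 1) p'"
      using p 1(2) by simp
    then obtain q1 r1 where 2: "p' = q1 @ D # r1" "descends 0 q1" "descends (h + 1) r1"
      using IH[of p' "h + 1"] p \<open>0 \<le> h\<close> by auto
    obtain q2 r2 where 3: "r1 = q2 @ D # r2" "descends 0 q2" "descends h r2"
      using IH[of r1 h] 2 p \<open>0 \<le> h\<close> by auto
    have "descends 0 (U # q1 @ D # q2)"
      using descends_append[OF 2(2), of 1 "D # q2"] 3(2) by simp
    moreover have "p = (U # q1 @ D # q2) @ D # r2"
      using p U 2(1) 3(1) by simp
    ultimately show ?thesis
      using 3(3) by blast
  next
    case D
    then show ?thesis
      using p 1(2) by (intro exI[of _ "[]"] exI[of _ p']) auto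
  next
    case T
    then obtain q r where "p' = q @ D # r" "descends 0 q" "descends h r"
      using IH[of p' h] p 1(2) \<open>0 \<le> h\<close> by auto
    then show ?thesis
      using p T by (intro exI[of _ "T # q"] exI[of _ r]) auto
  qed
qed

text \<open>
  If the two marked steps \<open>D\<close> were at different places, then the earlier one would be a step of the
  other piece, and it would lead that piece from the axis to the level below.
\<close>

lemma first_passage_unique:
  assumes eq: "p @ D # q = p' @ D # q'" and "descends 0 p" and "descends 0 p'"
  shows "p = p' \<and> q = q'"
proof -
  have no_proper_prefix: "\<not> descends 0 (r @ D # z)" if "descends 0 r" for r z
    using descends_append[OF that, of 0 "D # z"] descends_nonneg[of "-1" z] by auto
  have "(\<exists>z. p' = p @ z \<and> D # q = z @ D # q') \<or> (\<exists>z. p = p' @ z \<and> D # q' = z @ D # q)"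
    using eq unfolding append_eq_append_conv2 by metis
  then show ?thesis
  proof (elim disjE exE conjE)
    fix z assume "p' = p @ z" "D # q = z @ D # q'"
    then show ?thesis
      using no_proper_prefix assms by (cases z) auto
  next
    fix z assume "p = p' @ z" "D # q' = z @ D # q"
    then show ?thesis
      using no_proper_prefix assms by (cases z) auto
  qed
qed

text \<open>
  Every step changes the sum of the coordinates by an even amount, so a path that ends on the axis
  ends at an even abscissa.
\<close>

lemma descends_imp_schroeder_path:
  assumes "descends 0 p"
  obtains n where "schroeder_path n p"
proof -
  have "even (fst (endpoint p) + snd (endpoint p))"
  proof (induction p)
    case (Cons s p)
    then show ?case by (cases s) auto
  qed simp
  moreover have "snd (endpoint p) = 0"
    using assms by (simp add: descends_iff_prefix_heights)
  moreover have "0 \<le> fst (endpoint p)"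
    using length_le_endpoint[of p] by linarith
  ultimately obtain n where "fst (endpoint p) = 2 * int n"
    by (metis add.right_neutral evenE nonneg_int_cases zero_le_mult_iff not_numeral_le_zero)
  then show ?thesis
    using that assms schroeder_path_iff_descends by blast
qed

lemma schroeder_path_0_iff: "schroeder_path 0 p \<longleftrightarrow> p = []"
proof
  assume "schroeder_path 0 p"
  then show "p = []"
    using length_le_endpoint[of p] by (simp add: schroeder_path_def)
qed (simp add: schroeder_path_iff_descends)

lemma schroeder_path_T: "schroeder_path (Suc n) (T # p) \<longleftrightarrow> schroeder_path n p"
  by (auto simp: schroeder_path_iff_descends)

lemma schroeder_path_U_D:
  assumes "schroeder_path k p"
  shows "schroeder_path (Suc n) (U # p @ D # q) \<longleftrightarrow> k \<le> n \<and> schroeder_path (n - k) q"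
proof -
  have "descends 0 (U # p @ D # q) \<longleftrightarrow> descends 0 q"
    using assms descends_append[of 0 p 1 "D # q"] by (simp add: schroeder_path_iff_descends)
  moreover have "0 \<le> fst (endpoint q)"
    using length_le_endpoint[of q] by linarith
  ultimately show ?thesis
    using assms by (auto simp: schroeder_path_iff_descends)
qed

lemma schroeder_paths_Suc:
  "{p. schroeder_path (Suc n) p} =
     Cons T ` {p. schroeder_path n p} \<union>
     (\<lambda>(k, p, q). U # p @ D # q) `
       (SIGMA k:{..n}. {p. schroeder_path k p} \<times> {q. schroeder_path (n - k) q})"
  (is "?L = ?A \<union> ?B")
proof (intro equalityI subsetI)
  fix p assume "p \<in> ?A \<union> ?B"
  then show "p \<in> ?L"
    by (auto simp: schroeder_path_T schroeder_path_U_D)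
next
  fix p assume "p \<in> ?L"
  then have p: "schroeder_path (Suc n) p"
    by simp
  then obtain s r where sr: "p = s # r"
    by (cases p) (auto simp: schroeder_path_iff_descends)
  show "p \<in> ?A \<union> ?B"
  proof (cases s)
    case T
    then show ?thesis
      using p sr by (auto simp: schroeder_path_T)
  next
    case D
    then show ?thesis
      using p sr descends_nonneg[of "-1" r] by (auto simp: schroeder_path_iff_descends)
  next
    case U
    then have "descends (0 + 1) r"
      using p sr by (simp add: schroeder_path_iff_descends)
    then obtain q z where qz: "r = q @ D # z" "descends 0 q"
      using descends_first_passage[of 0 r] by auto
    obtain k where k: "schroeder_path k q"
      using descends_imp_schroeder_path[OF qz(2)] .
    then have "k \<le> n \<and> schroeder_path (n - k) z"
      using p sr U qz schroeder_path_U_D by simp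
    then show ?thesis
      using k sr U qz by (intro UnI2 image_eqI[of _ _ "(k, q, z)"]) auto
  qed
qed

lemma large_schroeder_0: "large_schroeder 0 = 1"
  by (simp add: large_schroeder_def schroeder_path_0_iff)

lemma large_schroeder_Suc:
  "large_schroeder (Suc n) =
     large_schroeder n + (\<Sum>k\<le>n. large_schroeder k * large_schroeder (n - k))"
proof -
  let ?P = "\<lambda>n. {p. schroeder_path n p}"
  let ?I = "SIGMA k:{..n}. ?P k \<times> ?P (n - k)"
  let ?f = "\<lambda>(k::nat, p, q). U # p @ D # q"
  have fin: "finite ?I"
    by (intro finite_SigmaI finite_atMost finite_schroeder_paths)
  have "inj_on ?f ?I"
  proof (rule inj_onI, clarsimp)
    fix k p q k' p' q'
    assume *: "schroeder_path k p" "schroeder_path k' p'" "p @ D # q = p' @ D # q'"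
    then have "descends 0 p" "descends 0 p'"
      by (simp_all add: schroeder_path_iff_descends)
    then have "p = p' \<and> q = q'"
      by (rule first_passage_unique[OF *(3)])
    then show "k = k' \<and> p = p' \<and> q = q'"
      using * by (simp add: schroeder_path_iff_descends)
  qed
  then have "card (?f ` ?I) = (\<Sum>k\<le>n. card (?P k) * card (?P (n - k)))"
    by (simp add: card_image finite_schroeder_paths card_cartesian_product)
  moreover have "card (?P (Suc n)) = card (Cons T ` ?P n) + card (?f ` ?I)"
    unfolding schroeder_paths_Suc
    by (intro card_Un_disjoint finite_imageI fin finite_schroeder_paths) auto
  moreover have "card (Cons T ` ?P n) = card (?P n)"
    by (intro card_image) simp
  ultimately show ?thesis
    unfolding large_schroeder_def by presburger
qed

lemma large_schroeder_mono: "large_schroeder n \<le> large_schroeder (Suc n)"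
  by (simp add: large_schroeder_Suc)

section \<open>The three-term recurrence\<close>

text \<open>
  For \<open>G = 1 - X - 2 X F\<close> and \<open>Q = 1 - 6 X + X\<^sup>2\<close>, differentiating \<open>G\<^sup>2 = Q\<close> gives \<open>2 G G' = Q'\<close>.
  Multiplication by \<open>G\<close> turns this into the equation \<open>2 Q G' = Q' G\<close>, which is linear in \<open>G\<close> and
  hence, up to initial terms, in the numbers \<open>S n\<close>.
\<close>

lemma large_schroeder_three_term:
  "real (n + 3) * large_schroeder (n + 2) =
     3 * real (2 * n + 3) * large_schroeder (n + 1) - real n * large_schroeder n"
proof -
  define F :: "real fps" where "F = Abs_fps (\<lambda>n. real (large_schroeder n))"
  define G where "G = 1 - fps_X - 2 * fps_X * F"
  let ?Q = "1 - 6 * fps_X + fps_X * fps_X :: real fps"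
  have F: "F = 1 + fps_X * (F + F * F)"
  proof (rule fps_ext)
    fix n
    have "(F * F) $ m = (\<Sum>k\<le>m. F $ k * F $ (m - k))" for m
      by (simp add: fps_mult_nth atLeast0AtMost)
    then show "F $ n = (1 + fps_X * (F + F * F)) $ n"
      by (cases n) (simp_all add: F_def large_schroeder_0 large_schroeder_Suc)
  qed
  have sq: "G * G = ?Q"
  proof -
    have "G * G = ?Q + 4 * fps_X * (1 + fps_X * (F + F * F) - F)"
      unfolding G_def by (simp add: algebra_simps)
    then show ?thesis
      using F by simp
  qed
  have "2 * (G * fps_deriv G) = fps_deriv (G * G)"
    by (simp add: algebra_simps)
  also have "\<dots> = 2 * (fps_X - 3)"
    unfolding sq by (simp add: algebra_simps)
  finally have "G * fps_deriv G = fps_X - 3"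
    using mult_left_cancel[of "2 :: real fps"] by (metis zero_neq_numeral)
  then have "?Q * fps_deriv G = (fps_X - 3) * G"
    by (simp only: sq[symmetric] mult.assoc mult.commute[of "fps_X - 3"])
  then have "fps_deriv G + fps_X * (fps_X * fps_deriv G) + fps_X * (- G) + 3 * G
      = 6 * (fps_X * fps_deriv G)"
    by (simp add: algebra_simps)
  then have "(fps_deriv G + fps_X * (fps_X * fps_deriv G) + fps_X * (- G) + 3 * G) $ (n + 2)
      = (6 * (fps_X * fps_deriv G)) $ (n + 2)"
    by (rule arg_cong)
  then have "real (n + 3) * G $ (n + 3) = 3 * real (2 * n + 3) * G $ (n + 2) - real n * G $ (n + 1)"
    by (simp add: numeral_fps_const numeral_eq_Suc algebra_simps)
  moreover have G_nth: "G $ Suc (Suc k) = - 2 * real (large_schroeder (Suc k))" for k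
    by (simp add: G_def F_def mult.assoc numeral_fps_const)
  \<comment> \<open>For \<open>n = 0\<close> the coefficient of \<open>X\<close> in \<open>G\<close> is \<open>- 1 - 2 S 0\<close>, but there it is multiplied by 0.\<close>
  moreover have "real n * G $ (n + 1) = - 2 * (real n * large_schroeder n)"
    using G_nth by (cases n) auto
  ultimately show ?thesis
    by (simp add: numeral_eq_Suc algebra_simps)
qed

section \<open>Log-convexity\<close>

theorem theorem2p4:
  shows "log_convex large_schroeder"
proof -
  let ?S = "\<lambda>n. real (large_schroeder n)"
  have "(?S (n + 1))\<^sup>2 \<le> ?S n * ?S (n + 2)" for n
  proof (induction n)
    case 0
    show ?case
      by (simp add: large_schroeder_0 large_schroeder_Suc numeral_2_eq_2)
  next
    case (Suc n)
    define d a b c where "d = ?S n" and "a = ?S (n + 1)" and "b = ?S (n + 2)" and "c = ?S (n + 3)"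
    have "a \<ge> 0" "a \<le> b"
      using large_schroeder_mono[of "n + 1"] by (simp_all add: a_def b_def)
    have b: "real (n + 3) * b = 3 * real (2 * n + 3) * a - real n * d"
      using large_schroeder_three_term[of n] by (simp add: a_def b_def d_def)
    have c: "real (n + 4) * c = 3 * real (2 * n + 5) * b - real (n + 1) * a"
      using large_schroeder_three_term[of "n + 1"] by (simp add: a_def b_def c_def numeral_eq_Suc)
    have "a\<^sup>2 \<le> b * d"
      using Suc.IH by (simp add: a_def b_def d_def mult.commute)
    then have "real n * real (n + 4) * a\<^sup>2 \<le> real n * real (n + 4) * (b * d)"
      by (intro mult_left_mono) auto
    \<comment> \<open>The remainder \<open>9 a b - 3 a\<^sup>2\<close>, where \<open>3 = (n + 1) (n + 3) - n (n + 4)\<close>.\<close>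
    moreover have "0 \<le> 3 * (a * (3 * b - a))"
      using \<open>a \<ge> 0\<close> \<open>a \<le> b\<close> by simp
    ultimately have "0 \<le> 9 * (a * b) - real (n + 1) * real (n + 3) * a\<^sup>2 + real n * real (n + 4) * (b * d)"
      by (simp add: algebra_simps power2_eq_square)
    also have "\<dots> = real (n + 3) * a * (3 * real (2 * n + 5) * b - real (n + 1) * a)
        - real (n + 4) * b * (3 * real (2 * n + 3) * a - real n * d)"
      by (simp add: algebra_simps power2_eq_square)
    also have "\<dots> = real (n + 3) * real (n + 4) * (a * c - b\<^sup>2)"
      unfolding b[symmetric] c[symmetric] by (simp add: algebra_simps power2_eq_square)
    finally have "b\<^sup>2 \<le> a * c"
      by (simp add: zero_le_mult_iff mult_le_0_iff)
    then show ?case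
      by (simp add: a_def b_def c_def numeral_eq_Suc)
  qed
  then have "(large_schroeder (n + 1))\<^sup>2 \<le> large_schroeder n * large_schroeder (n + 2)" for n
    by (metis of_nat_le_iff of_nat_mult of_nat_power)
  then show ?thesis
    unfolding log_convex_def by (metis Suc_eq_plus1 add_2_eq_Suc' le_add_diff_inverse2)
qed

end
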